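(* Let $A$ be a pseudo BCK-algebra and $H$ a normal deductive system of $A$. Then $H$ is a commutative deductive system of $A$ if and only if $A/H$ is a commutative pseudo BCK-algebra.
   Context: A pseudo BCK-algebra is an algebra $(A,\rightarrow,\rightsquigarrow,1)$ of type $(2,2,0)$ such that for all $x,y,z\in A$: $(x\rightarrow y)\rightsquigarrow[(y\rightarrow z)\rightsquigarrow(x\rightarrow z)]=1$; $(x\rightsquigarrow y)\rightarrow[(y\rightsquigarrow z)\rightarrow(x\rightsquigarrow z)]=1$; $1\rightarrow x=x$; $1\rightsquigarrow x=x$; $x\rightarrow 1=1$; and if $x\rightarrow y=1$ and $y\rightarrow x=1$ then $x=y$. The order is $x\le y$ iff $x\rightarrow y=1$ (iff $x\rightsquigarrow y=1$). $A$ is commutative if $(x\rightarrow y)\rightsquigarrow y=(y\rightarrow x)\rightsquigarrow x$ and $(x\rightsquigarrow y)\rightarrow y=(y\rightsquigarrow x)\rightarrow x$ for all $x,y$. A deductive system of $A$ is a subset $D\subseteq A$ with $1\in D$ such that $x\in D$ and $x\rightarrow y\in D$ imply $y\in D$. It is normal if for all $x,y$: $x\rightarrow y\in D$ iff $x\rightsquigarrow y\in D$. It is commutative if for all $x,y$: $y\rightarrow x\in D$ implies $((x\rightarrow y)\rightsquigarrow y)\rightarrow x\in D$, and $y\rightsquigarrow x\in D$ implies $((x\rightsquigarrow y)\rightarrow y)\rightsquigarrow x\in D$. For a normal deductive system $H$, the relation $\Theta_H$ given by $(x,y)\in\Theta_H$ iff $x\rightarrow y\in H$ and $y\rightarrow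 x\in H$ is a congruence, and $A/H=(A/\Theta_H,\rightarrow,\rightsquigarrow,[1]_{\Theta_H})$ with the induced operations is a pseudo BCK-algebra, with $[1]_{\Theta_H}=H$. *)

theory Defs
  imports Main
begin

record 'a pbck =
  carrier :: "'a set"
  arr :: "'a \<Rightarrow> 'a \<Rightarrow> 'a" (infixr \<open>\<rightarrow>\<index>\<close> 60)
  sqarr :: "'a \<Rightarrow> 'a \<Rightarrow> 'a" (infixr \<open>\<leadsto>\<index>\<close> 60)
  one :: 'a (\<open>\<one>\<index>\<close>)

locale pseudo_BCK =
  fixes A :: "('a, 'm) pbck_scheme" (structure)
  assumes arr_closed: "\<lbrakk>x \<in> carrier A; y \<in> carrier A\<rbrakk> \<Longrightarrow> x \<rightarrow> y \<in> carrier A"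
    and sqarr_closed: "\<lbrakk>x \<in> carrier A; y \<in> carrier A\<rbrakk> \<Longrightarrow> x \<leadsto> y \<in> carrier A"
    and one_closed: "\<one> \<in> carrier A"
    and arr_trans: "\<lbrakk>x \<in> carrier A; y \<in> carrier A; z \<in> carrier A\<rbrakk>
      \<Longrightarrow> (x \<rightarrow> y) \<leadsto> ((y \<rightarrow> z) \<leadsto> (x \<rightarrow> z)) = \<one>"
    and sqarr_trans: "\<lbrakk>x \<in> carrier A; y \<in> carrier A; z \<in> carrier A\<rbrakk>
      \<Longrightarrow> (x \<leadsto> y) \<rightarrow> ((y \<leadsto> z) \<rightarrow> (x \<leadsto> z)) = \<one>"
    and one_arr: "x \<in> carrier A \<Longrightarrow> \<one> \<rightarrow> x = x"
    and one_sqarr: "x \<in> carrier A \<Longrightarrow> \<one> \<leadsto> x = x"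
    and arr_one: "x \<in> carrier A \<Longrightarrow> x \<rightarrow> \<one> = \<one>"
    and arr_antisym: "\<lbrakk>x \<in> carrier A; y \<in> carrier A; x \<rightarrow> y = \<one>; y \<rightarrow> x = \<one>\<rbrakk> \<Longrightarrow> x = y"

locale commutative_pseudo_BCK = pseudo_BCK +
  assumes arr_comm: "\<lbrakk>x \<in> carrier A; y \<in> carrier A\<rbrakk>
      \<Longrightarrow> (x \<rightarrow> y) \<leadsto> y = (y \<rightarrow> x) \<leadsto> x"
    and sqarr_comm: "\<lbrakk>x \<in> carrier A; y \<in> carrier A\<rbrakk>
      \<Longrightarrow> (x \<leadsto> y) \<rightarrow> y = (y \<leadsto> x) \<rightarrow> x"

definition deductive_system :: "('a, 'm) pbck_scheme \<Rightarrow> 'a set \<Rightarrow> bool" where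
  "deductive_system A D \<longleftrightarrow>
     D \<subseteq> carrier A \<and> \<one>\<^bsub>A\<^esub> \<in> D \<and>
     (\<forall>x\<in>carrier A. \<forall>y\<in>carrier A. x \<in> D \<longrightarrow> x \<rightarrow>\<^bsub>A\<^esub> y \<in> D \<longrightarrow> y \<in> D)"

definition normal_deductive_system :: "('a, 'm) pbck_scheme \<Rightarrow> 'a set \<Rightarrow> bool" where
  "normal_deductive_system A D \<longleftrightarrow>
     deductive_system A D \<and>
     (\<forall>x\<in>carrier A. \<forall>y\<in>carrier A. x \<rightarrow>\<^bsub>A\<^esub> y \<in> D \<longleftrightarrow> x \<leadsto>\<^bsub>A\<^esub> y \<in> D)"

definition commutative_deductive_system :: "('a, 'm) pbck_scheme \<Rightarrow> 'a set \<Rightarrow> bool" where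
  "commutative_deductive_system A D \<longleftrightarrow>
     deductive_system A D \<and>
     (\<forall>x\<in>carrier A. \<forall>y\<in>carrier A.
        (y \<rightarrow>\<^bsub>A\<^esub> x \<in> D \<longrightarrow> ((x \<rightarrow>\<^bsub>A\<^esub> y) \<leadsto>\<^bsub>A\<^esub> y) \<rightarrow>\<^bsub>A\<^esub> x \<in> D) \<and>
        (y \<leadsto>\<^bsub>A\<^esub> x \<in> D \<longrightarrow> ((x \<leadsto>\<^bsub>A\<^esub> y) \<rightarrow>\<^bsub>A\<^esub> y) \<leadsto>\<^bsub>A\<^esub> x \<in> D))"

definition Theta :: "('a, 'm) pbck_scheme \<Rightarrow> 'a set \<Rightarrow> ('a \<times> 'a) set" where
  "Theta A H = {(x, y). x \<in> carrier A \<and> y \<in> carrier A \<and> x \<rightarrow>\<^bsub>A\<^esub> y \<in> H \<and> y \<rightarrow>\<^bsub>A\<^esub> x \<in> H}"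

text \<open>
  The induced operations send classes \<open>X\<close>, \<open>Y\<close> to the union of the classes of \<open>x \<rightarrow> y\<close>
  (respectively \<open>x \<leadsto> y\<close>) over all representatives \<open>x \<in> X\<close>, \<open>y \<in> Y\<close>. When \<open>Theta A H\<close> is a
  congruence, in particular for every normal deductive system \<open>H\<close>, all these classes coincide,
  so that \<open>[x] \<rightarrow> [y] = [x \<rightarrow> y]\<close> and \<open>[x] \<leadsto> [y] = [x \<leadsto> y]\<close>.
\<close>

definition quotient_pbck :: "('a, 'm) pbck_scheme \<Rightarrow> 'a set \<Rightarrow> 'a set pbck" where
  "quotient_pbck A H =
     \<lparr>carrier = carrier A // Theta A H,
      arr = (\<lambda>X Y. \<Union>x\<in>X. \<Union>y\<in>Y. Theta A H `` {x \<rightarrow>\<^bsub>A\<^esub> y}),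
      sqarr = (\<lambda>X Y. \<Union>x\<in>X. \<Union>y\<in>Y. Theta A H `` {x \<leadsto>\<^bsub>A\<^esub> y}),
      one = Theta A H `` {\<one>\<^bsub>A\<^esub>}\<rparr>"

end

theory Submission
  imports Defs
begin

text \<open>
  A pseudo BCK-algebra is commutative iff \<open>y \<le> x\<close> implies
  \<open>(x \<rightarrow> y) \<leadsto> y \<le> x\<close> and \<open>(x \<leadsto> y) \<rightarrow> y \<le> x\<close>. Indeed, given this law put
  \<open>u = (x \<rightarrow> y) \<leadsto> y\<close>. Then \<open>x \<le> u\<close> and \<open>y \<le> u\<close>, so that
  \<open>(y \<rightarrow> x) \<leadsto> x \<le> (u \<rightarrow> x) \<leadsto> x \<le> u\<close>, and symmetry gives equality. Since a class is the
  unit of the quotient by \<open>H\<close> exactly when its representatives lie in \<open>H\<close>, the law for the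
  quotient is the commutativity condition for \<open>H\<close>.
\<close>

section \<open>Order and residuation in a pseudo BCK-algebra\<close>

context pseudo_BCK
begin

lemmas closed = arr_closed sqarr_closed one_closed

lemma le_sqarr_arr:
  assumes "x \<in> carrier A" "y \<in> carrier A"
  shows "x \<leadsto> ((x \<rightarrow> y) \<leadsto> y) = \<one>"
  using arr_trans[of \<one> x y] assms by (simp add: closed one_arr)

lemma le_arr_sqarr:
  assumes "x \<in> carrier A" "y \<in> carrier A"
  shows "x \<rightarrow> ((x \<leadsto> y) \<rightarrow> y) = \<one>"
  using sqarr_trans[of \<one> x y] assms by (simp add: closed one_sqarr)

text \<open>If one implication equals \<open>\<one>\<close>, then in \<open>le_sqarr_arr\<close> or
  \<open>le_arr_sqarr\<close> the inner term reduces to \<open>y\<close>, leaving the other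
  implication. Hence both define the same order, written with \<open>\<rightarrow>\<close> from here
  on.\<close>

lemma arr_eq_one_iff:
  assumes "x \<in> carrier A" "y \<in> carrier A"
  shows "x \<rightarrow> y = \<one> \<longleftrightarrow> x \<leadsto> y = \<one>"
  using le_sqarr_arr[OF assms] le_arr_sqarr[OF assms] assms
  by (auto simp: one_arr one_sqarr)

lemma arr_refl: "x \<in> carrier A \<Longrightarrow> x \<rightarrow> x = \<one>"
  using le_arr_sqarr[of \<one> x] by (simp add: closed one_arr one_sqarr)

lemma arr_antitone:
  assumes "x \<in> carrier A" "y \<in> carrier A" "z \<in> carrier A" "x \<rightarrow> y = \<one>"
  shows "(y \<rightarrow> z) \<rightarrow> (x \<rightarrow> z) = \<one>"
  using arr_trans[of x y z] assms by (simp add: closed one_sqarr arr_eq_one_iff)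

lemma sqarr_antitone:
  assumes "x \<in> carrier A" "y \<in> carrier A" "z \<in> carrier A" "x \<rightarrow> y = \<one>"
  shows "(y \<leadsto> z) \<rightarrow> (x \<leadsto> z) = \<one>"
  using sqarr_trans[of x y z] assms by (simp add: closed one_sqarr arr_eq_one_iff)

lemma le_trans:
  assumes "x \<in> carrier A" "y \<in> carrier A" "z \<in> carrier A" "x \<rightarrow> y = \<one>" "y \<rightarrow> z = \<one>"
  shows "x \<rightarrow> z = \<one>"
  using arr_trans[of x y z] assms by (simp add: closed one_sqarr)

text \<open>In either direction, antitonicity in the first argument is applied to the given
  inequality, and the unit law \<open>le_sqarr_arr\<close> or \<open>le_arr_sqarr\<close> is
  prefixed by transitivity. The exchange of premises swaps the two arrows.\<close>

lemma residuation:
  assumes "x \<in> carrier A" "y \<in> carrier A" "z \<in> carrier A"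
  shows "x \<rightarrow> (y \<rightarrow> z) = \<one> \<longleftrightarrow> y \<rightarrow> (x \<leadsto> z) = \<one>"
proof
  assume "x \<rightarrow> (y \<rightarrow> z) = \<one>"
  then have "((y \<rightarrow> z) \<leadsto> z) \<rightarrow> (x \<leadsto> z) = \<one>"
    using assms by (simp add: sqarr_antitone closed)
  moreover have "y \<rightarrow> ((y \<rightarrow> z) \<leadsto> z) = \<one>"
    using assms by (simp add: arr_eq_one_iff le_sqarr_arr closed)
  ultimately show "y \<rightarrow> (x \<leadsto> z) = \<one>"
    using assms le_trans[of y "(y \<rightarrow> z) \<leadsto> z" "x \<leadsto> z"] by (simp add: closed)
next
  assume "y \<rightarrow> (x \<leadsto> z) = \<one>"
  then have "((x \<leadsto> z) \<rightarrow> z) \<rightarrow> (y \<rightarrow> z) = \<one>"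
    using assms by (simp add: arr_antitone closed)
  moreover have "x \<rightarrow> ((x \<leadsto> z) \<rightarrow> z) = \<one>"
    using assms by (simp add: le_arr_sqarr)
  ultimately show "x \<rightarrow> (y \<rightarrow> z) = \<one>"
    using assms le_trans[of x "(x \<leadsto> z) \<rightarrow> z" "y \<rightarrow> z"] by (simp add: closed)
qed

text \<open>Residuation reduces this to \<open>x \<le> y \<leadsto> y\<close>, whose right side is
  \<open>\<one>\<close>.\<close>

lemma le_arr:
  assumes "x \<in> carrier A" "y \<in> carrier A"
  shows "y \<rightarrow> (x \<rightarrow> y) = \<one>"
  using assms residuation[of y x y] arr_refl[of y] arr_one arr_eq_one_iff[of y y]
  by (simp add: closed)

lemma le_sqarr:
  assumes "x \<in> carrier A" "y \<in> carrier A"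
  shows "y \<rightarrow> (x \<leadsto> y) = \<one>"
  using assms residuation[of x y y] arr_refl[of y] arr_one by (simp add: closed)

text \<open>This is \<open>arr_trans\<close> with its two premises exchanged by residuation.\<close>

lemma arr_mono_one:
  assumes "x \<in> carrier A" "y \<in> carrier A" "z \<in> carrier A"
  shows "(y \<rightarrow> z) \<rightarrow> ((x \<rightarrow> y) \<rightarrow> (x \<rightarrow> z)) = \<one>"
  using assms arr_trans[of x y z] residuation[of "y \<rightarrow> z" "x \<rightarrow> y" "x \<rightarrow> z"]
  by (simp add: closed arr_eq_one_iff)

lemma sqarr_mono_one:
  assumes "x \<in> carrier A" "y \<in> carrier A" "z \<in> carrier A"
  shows "(y \<leadsto> z) \<rightarrow> ((x \<leadsto> y) \<leadsto> (x \<leadsto> z)) = \<one>"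
  using assms sqarr_trans[of x y z] residuation[of "x \<leadsto> y" "y \<leadsto> z" "x \<leadsto> z"]
  by (simp add: closed)

lemma commutative_iff:
  "commutative_pseudo_BCK A \<longleftrightarrow>
     (\<forall>x\<in>carrier A. \<forall>y\<in>carrier A.
        (y \<rightarrow> x = \<one> \<longrightarrow> ((x \<rightarrow> y) \<leadsto> y) \<rightarrow> x = \<one>) \<and>
        (y \<leadsto> x = \<one> \<longrightarrow> ((x \<leadsto> y) \<rightarrow> y) \<leadsto> x = \<one>))" (is "_ \<longleftrightarrow> ?R")
proof
  assume "commutative_pseudo_BCK A"
  then interpret commutative_pseudo_BCK A .
  show ?R
  proof (intro ballI conjI impI)
    fix x y assume "x \<in> carrier A" "y \<in> carrier A" "y \<rightarrow> x = \<one>"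
    then show "((x \<rightarrow> y) \<leadsto> y) \<rightarrow> x = \<one>"
      \<comment> \<open>Commutativity turns the premise into
        \<open>(y \<rightarrow> x) \<leadsto> x = \<one> \<leadsto> x = x\<close>.\<close>
      by (simp add: arr_comm[of x y] one_sqarr arr_refl)
  next
    fix x y assume "x \<in> carrier A" "y \<in> carrier A" "y \<leadsto> x = \<one>"
    then show "((x \<leadsto> y) \<rightarrow> y) \<leadsto> x = \<one>"
      using arr_eq_one_iff[of x x] by (simp add: sqarr_comm[of x y] one_arr arr_refl)
  qed
next
  assume R: ?R
  have 1: "((y \<rightarrow> x) \<leadsto> x) \<rightarrow> ((x \<rightarrow> y) \<leadsto> y) = \<one>"
    if "x \<in> carrier A" "y \<in> carrier A" for x y
  proof -
    let ?u = "(x \<rightarrow> y) \<leadsto> y"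
    have u: "?u \<in> carrier A" "x \<rightarrow> ?u = \<one>" "y \<rightarrow> ?u = \<one>"
      using that by (simp_all add: closed arr_eq_one_iff le_sqarr_arr le_sqarr)
    \<comment> \<open>Two antitone steps starting from \<open>y \<le> ?u\<close> compose to a
      monotone one.\<close>
    then have "((y \<rightarrow> x) \<leadsto> x) \<rightarrow> ((?u \<rightarrow> x) \<leadsto> x) = \<one>"
      using that by (intro sqarr_antitone arr_antitone closed)
    moreover have "((?u \<rightarrow> x) \<leadsto> x) \<rightarrow> ?u = \<one>"
      using R that u by simp
    ultimately show ?thesis
      using that le_trans[of "(y \<rightarrow> x) \<leadsto> x" "(?u \<rightarrow> x) \<leadsto> x" ?u] by (simp add: closed)
  qed
  have 2: "((y \<leadsto> x) \<rightarrow> x) \<rightarrow> ((x \<leadsto> y) \<rightarrow> y) = \<one>"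
    if "x \<in> carrier A" "y \<in> carrier A" for x y
  proof -
    let ?u = "(x \<leadsto> y) \<rightarrow> y"
    have u: "?u \<in> carrier A" "x \<rightarrow> ?u = \<one>" "y \<rightarrow> ?u = \<one>"
      using that by (simp_all add: closed le_arr_sqarr le_arr)
    then have "((y \<leadsto> x) \<rightarrow> x) \<rightarrow> ((?u \<leadsto> x) \<rightarrow> x) = \<one>"
      using that by (intro sqarr_antitone arr_antitone closed)
    moreover have "((?u \<leadsto> x) \<rightarrow> x) \<rightarrow> ?u = \<one>"
      \<comment> \<open>The second clause of the law is stated with \<open>\<leadsto>\<close>, so
        its premise and conclusion are converted to \<open>\<rightarrow>\<close>.\<close>
      using R u that by (simp add: arr_eq_one_iff closed)
    ultimately show ?thesis
      using that le_trans[of "(y \<leadsto> x) \<rightarrow> x" "(?u \<leadsto> x) \<rightarrow> x" ?u] by (simp add: closed)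
  qed
  show "commutative_pseudo_BCK A"
    by unfold_locales (auto intro!: arr_antisym closed 1 2)
qed

end

section \<open>Membership in a normal deductive system\<close>

locale pseudo_BCK_normal = pseudo_BCK +
  fixes H
  assumes normal: "normal_deductive_system A H"
begin

lemma one_in: "\<one> \<in> H"
  using normal by (simp add: normal_deductive_system_def deductive_system_def)

lemma arr_in_iff: "\<lbrakk>x \<in> carrier A; y \<in> carrier A\<rbrakk> \<Longrightarrow> x \<rightarrow> y \<in> H \<longleftrightarrow> x \<leadsto> y \<in> H"
  using normal by (simp add: normal_deductive_system_def)

lemma arr_mp: "\<lbrakk>x \<rightarrow> y \<in> H; x \<in> H; y \<in> carrier A\<rbrakk> \<Longrightarrow> y \<in> H"
  using normal by (auto simp: normal_deductive_system_def deductive_system_def)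

text \<open>Modus ponens with \<open>\<one> \<in> H\<close> makes \<open>H\<close> an up-set, so
  inequalities of the algebra carry membership upward.\<close>

lemma in_mono: "\<lbrakk>x \<rightarrow> y = \<one>; x \<in> H; y \<in> carrier A\<rbrakk> \<Longrightarrow> y \<in> H"
  using arr_mp one_in by metis

lemma in_trans:
  assumes "x \<in> carrier A" "y \<in> carrier A" "z \<in> carrier A" "x \<rightarrow> y \<in> H" "y \<rightarrow> z \<in> H"
  shows "x \<rightarrow> z \<in> H"
proof -
  have "(x \<rightarrow> y) \<rightarrow> (x \<rightarrow> z) \<in> H"
    by (rule in_mono[OF arr_mono_one[of x y z]]) (use assms in \<open>simp_all add: closed\<close>)
  then show ?thesis
    using assms arr_mp by (simp add: closed)
qed

text \<open>The first of four facts, up to \<open>sqarr_in_mono\<close>, that make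
  \<open>Theta A H\<close> a congruence. In each, an inequality of the algebra places the term above
  an element of \<open>H\<close>; where the arrows do not match, normality exchanges them.\<close>

lemma arr_in_antitone:
  assumes "x \<in> carrier A" "y \<in> carrier A" "z \<in> carrier A" "x \<rightarrow> y \<in> H"
  shows "(y \<rightarrow> z) \<rightarrow> (x \<rightarrow> z) \<in> H"
  using in_mono[of "x \<rightarrow> y" "(y \<rightarrow> z) \<leadsto> (x \<rightarrow> z)"] arr_trans[of x y z] assms
  by (simp add: closed arr_in_iff arr_eq_one_iff)

lemma sqarr_in_antitone:
  assumes "x \<in> carrier A" "y \<in> carrier A" "z \<in> carrier A" "x \<rightarrow> y \<in> H"
  shows "(y \<leadsto> z) \<rightarrow> (x \<leadsto> z) \<in> H"
  using in_mono[of "x \<leadsto> y" "(y \<leadsto> z) \<rightarrow> (x \<leadsto> z)"] sqarr_trans[of x y z] assms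
  by (simp add: closed arr_in_iff)

lemma arr_in_mono:
  assumes "x \<in> carrier A" "y \<in> carrier A" "z \<in> carrier A" "y \<rightarrow> z \<in> H"
  shows "(x \<rightarrow> y) \<rightarrow> (x \<rightarrow> z) \<in> H"
  by (rule in_mono[OF arr_mono_one[of x y z]]) (use assms in \<open>simp_all add: closed\<close>)

lemma sqarr_in_mono:
  assumes "x \<in> carrier A" "y \<in> carrier A" "z \<in> carrier A" "y \<rightarrow> z \<in> H"
  shows "(x \<leadsto> y) \<rightarrow> (x \<leadsto> z) \<in> H"
  using in_mono[OF sqarr_mono_one[of x y z]] assms by (simp add: closed arr_in_iff)

section \<open>The quotient algebra\<close>

abbreviation cls :: "'a \<Rightarrow> 'a set" where
  "cls x \<equiv> Theta A H `` {x}"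

abbreviation Q :: "'a set pbck" where
  "Q \<equiv> quotient_pbck A H"

lemma Theta_iff:
  "(x, y) \<in> Theta A H \<longleftrightarrow> x \<in> carrier A \<and> y \<in> carrier A \<and> x \<rightarrow> y \<in> H \<and> y \<rightarrow> x \<in> H"
  by (simp add: Theta_def)

lemma equiv_Theta: "equiv (carrier A) (Theta A H)"
proof (rule equivI)
  show "trans (Theta A H)"
    by (rule transI) (simp add: Theta_iff, blast intro: in_trans)
qed (auto intro!: refl_onI symI simp: Theta_iff arr_refl one_in)

lemma cls_eq_iff:
  assumes "x \<in> carrier A" "y \<in> carrier A"
  shows "cls x = cls y \<longleftrightarrow> x \<rightarrow> y \<in> H \<and> y \<rightarrow> x \<in> H"
  using eq_equiv_class_iff[OF equiv_Theta assms] assms by (simp add: Theta_iff)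

text \<open>Varying one argument at a time suffices, and each one-sided fact is used for both
  \<open>y \<rightarrow> z\<close> and \<open>z \<rightarrow> y\<close>. Congruence is what
  collapses the unions in \<open>quotient_pbck\<close> to a single class.\<close>

lemma arr_congruent: "congruent2 (Theta A H) (Theta A H) (\<lambda>x y. cls (x \<rightarrow> y))"
proof (rule congruent2I[OF equiv_Theta equiv_Theta])
  show "cls (y \<rightarrow> x) = cls (z \<rightarrow> x)" if "x \<in> carrier A" "(y, z) \<in> Theta A H" for x y z
    using that by (simp add: Theta_iff cls_eq_iff closed arr_in_antitone)
  show "cls (x \<rightarrow> y) = cls (x \<rightarrow> z)" if "x \<in> carrier A" "(y, z) \<in> Theta A H" for x y z
    using that by (simp add: Theta_iff cls_eq_iff closed arr_in_mono)
qed

lemma sqarr_congruent: "congruent2 (Theta A H) (Theta A H) (\<lambda>x y. cls (x \<leadsto> y))"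
proof (rule congruent2I[OF equiv_Theta equiv_Theta])
  show "cls (y \<leadsto> x) = cls (z \<leadsto> x)" if "x \<in> carrier A" "(y, z) \<in> Theta A H" for x y z
    using that by (simp add: Theta_iff cls_eq_iff closed sqarr_in_antitone)
  show "cls (x \<leadsto> y) = cls (x \<leadsto> z)" if "x \<in> carrier A" "(y, z) \<in> Theta A H" for x y z
    using that by (simp add: Theta_iff cls_eq_iff closed sqarr_in_mono)
qed

lemma quotient_carrier: "carrier Q = cls ` carrier A"
  by (auto simp: quotient_pbck_def quotient_def)

lemma quotient_one: "\<one>\<^bsub>Q\<^esub> = cls \<one>"
  by (simp add: quotient_pbck_def)

lemma quotient_arr:
  "\<lbrakk>x \<in> carrier A; y \<in> carrier A\<rbrakk> \<Longrightarrow> cls x \<rightarrow>\<^bsub>Q\<^esub> cls y = cls (x \<rightarrow> y)"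
  by (simp add: quotient_pbck_def UN_equiv_class2[OF equiv_Theta equiv_Theta arr_congruent])

lemma quotient_sqarr:
  "\<lbrakk>x \<in> carrier A; y \<in> carrier A\<rbrakk> \<Longrightarrow> cls x \<leadsto>\<^bsub>Q\<^esub> cls y = cls (x \<leadsto> y)"
  by (simp add: quotient_pbck_def UN_equiv_class2[OF equiv_Theta equiv_Theta sqarr_congruent])

lemmas quotient_simps = quotient_carrier quotient_one quotient_arr quotient_sqarr

text \<open>Of the two memberships that define the congruence, \<open>x \<rightarrow> \<one>\<close>
  is \<open>\<one>\<close> and \<open>\<one> \<rightarrow> x\<close> is \<open>x\<close>.\<close>

lemma cls_eq_one_iff:
  assumes "x \<in> carrier A"
  shows "cls x = cls \<one> \<longleftrightarrow> x \<in> H"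
  using assms by (simp add: cls_eq_iff closed one_arr arr_one one_in)

lemma quotient_pseudo_BCK: "pseudo_BCK Q"
proof
  \<comment> \<open>Antisymmetry is an implication, so it does not descend from \<open>A\<close> as
    the identities do. Its premises place \<open>x \<rightarrow> y\<close> and
    \<open>y \<rightarrow> x\<close> in \<open>H\<close>, which is equality of the classes.\<close>
  fix X Y
  assume "X \<in> carrier Q" "Y \<in> carrier Q"
  then obtain x y where "x \<in> carrier A" "y \<in> carrier A" "X = cls x" "Y = cls y"
    by (auto simp: quotient_carrier)
  moreover assume "X \<rightarrow>\<^bsub>Q\<^esub> Y = \<one>\<^bsub>Q\<^esub>" "Y \<rightarrow>\<^bsub>Q\<^esub> X = \<one>\<^bsub>Q\<^esub>"
  ultimately show "X = Y"
    using cls_eq_one_iff[of "x \<rightarrow> y"] cls_eq_one_iff[of "y \<rightarrow> x"]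
    by (simp add: quotient_arr quotient_one arr_closed cls_eq_iff[of x y])
qed (auto simp: quotient_simps closed arr_trans sqarr_trans one_arr one_sqarr arr_one)

text \<open>With classes replaced by representatives, \<open>commutative_iff\<close> for
  \<open>Q\<close> consists of equations with \<open>cls \<one>\<close>. Reading each as membership
  in \<open>H\<close> yields the defining clauses of the left side.\<close>

lemma commutative_deductive_system_iff:
  "commutative_deductive_system A H \<longleftrightarrow> commutative_pseudo_BCK Q"
proof -
  have "deductive_system A H"
    using normal by (simp add: normal_deductive_system_def)
  then show ?thesis
    by (simp add: pseudo_BCK.commutative_iff[OF quotient_pseudo_BCK]
        commutative_deductive_system_def quotient_simps closed cls_eq_one_iff)
qed

end

theorem theorem4p9:
  fixes A :: "('a, 'm) pbck_scheme" and H :: "'a set"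
  assumes "pseudo_BCK A"
    and "normal_deductive_system A H"
  shows "commutative_deductive_system A H \<longleftrightarrow> commutative_pseudo_BCK (quotient_pbck A H)"
proof -
  interpret pseudo_BCK_normal A H
    using assms by (simp add: pseudo_BCK_normal_def pseudo_BCK_normal_axioms_def)
  show ?thesis
    by (rule commutative_deductive_system_iff)
qed

end
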